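(* Let $n,k$ be positive integers and let $\mathcal{W}=\{0,w_1,\dotsc,w_{n+k}\}\subset\mathbb{R}^n$ consist of $n+k+1$ vectors such that the last $n$ vectors $w_{k+1},\dotsc,w_{n+k}$ are linearly independent. Let $p_1,\dotsc,p_n$ be real polynomials of degree at most $1$ in $y=(y_1,\dotsc,y_k)$, and consider the diagonal system on $\mathbb{R}^n_{>}$ \[ z^{w_i}\ =\ p_i(z^{w_{n+1}},z^{w_{n+2}},\dotsc,z^{w_{n+k}})\qquad\text{for } i=1,\dotsc,n. \tag{D} \] Set $p_{n+i}(y):=y_i$ for $i=1,\dotsc,k$, let \[ \Delta:=\{y\in\mathbb{R}^k \mid p_i(y)>0 \text{ for } i=1,\dotsc,n+k\}\subset\mathbb{R}^k_{>}, \] let $A=(a_{i,j})\in\mathbb{R}^{(n+k)\times k}$ be a matrix whose columns form a basis of the space of linear relations $\{a\in\mathbb{R}^{n+k}: \sum_{i=1}^{n+k} a_i w_i=0\}$, and consider the Gale system on $\Delta$ \[ 1\ =\ \prod_{i=1}^{n+k}p_i(y)^{a_{i,j}}\qquad\text{for } j=1,\dotsc,k. \tag{G} \] Then the map \[ \varphi\colon \mathbb{R}^n_{>}\ni z\longmapsto (z^{w_{n+1}},z^{w_{n+2}},\dotsc,z^{w_{n+k}})=:y\in\mathbb{R}^k_{>} \] is a bijection between the solutions $z\in\mathbb{R}^n_{>}$ of the diagonal system (D) and the solutions $y\in\Delta$ of the Gale system (G), and it restricts to a bijection between their non-degenerate solutions.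
   Context: $\mathbb{R}^m_{>}$ is the open positive orthant of $\mathbb{R}^m$, and $z^w=\prod_i z_i^{w^{(i)}}$ for $w=(w^{(1)},\dotsc,w^{(n)})\in\mathbb{R}^n$. A solution of a system of $m$ equations $g_1=h_1,\dotsc,g_m=h_m$ in $m$ variables is non-degenerate if the differentials of $g_1-h_1,\dotsc,g_m-h_m$ are linearly independent at it. *)

theory Defs
  imports "HOL-Analysis.Analysis"
begin

definition pos_orthant :: "(real ^ 'm) set" where
  "pos_orthant = {x. \<forall>i. x $ i > 0}"

definition monomial :: "real ^ 'm \<Rightarrow> real ^ 'm \<Rightarrow> real" where
  "monomial z w = (\<Prod>i\<in>UNIV. (z $ i) powr (w $ i))"

definition poly_deg_le_1 :: "(real ^ 'm \<Rightarrow> real) \<Rightarrow> bool" where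
  "poly_deg_le_1 p \<longleftrightarrow> (\<exists>c b. \<forall>y. p y = c + (\<Sum>j\<in>UNIV. b $ j * y $ j))"

definition solutions ::
  "'a set \<Rightarrow> nat set \<Rightarrow> (nat \<Rightarrow> 'a \<Rightarrow> real) \<Rightarrow> (nat \<Rightarrow> 'a \<Rightarrow> real) \<Rightarrow> 'a set" where
  "solutions S I g h = {x \<in> S. \<forall>i\<in>I. g i x = h i x}"

text \<open>The differentials are required to be linearly independent as an indexed family,
  hence the injectivity condition.\<close>

definition nondegenerate_at ::
  "nat set \<Rightarrow> (nat \<Rightarrow> 'a \<Rightarrow> real) \<Rightarrow> (nat \<Rightarrow> 'a \<Rightarrow> real) \<Rightarrow> 'a::euclidean_space \<Rightarrow> bool" where
  "nondegenerate_at I g h x \<longleftrightarrow>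
     (\<exists>D :: nat \<Rightarrow> 'a \<Rightarrow>\<^sub>L real.
        (\<forall>i\<in>I. ((\<lambda>u. g i u - h i u) has_derivative blinfun_apply (D i)) (at x)) \<and>
        inj_on D I \<and> independent (D ` I))"

definition nondeg_solutions ::
  "'a::euclidean_space set \<Rightarrow> nat set \<Rightarrow> (nat \<Rightarrow> 'a \<Rightarrow> real) \<Rightarrow> (nat \<Rightarrow> 'a \<Rightarrow> real) \<Rightarrow> 'a set" where
  "nondeg_solutions S I g h = {x \<in> solutions S I g h. nondegenerate_at I g h x}"

text \<open>Elements of \<open>\<real>\<^sup>m\<close> are represented here by functions on \<open>nat\<close>
  of which only the values on \<open>{1..m}\<close> matter; \<open>A i j\<close> is the entry in row \<open>i\<close>, column \<open>j\<close>.\<close>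

definition linear_relation :: "nat \<Rightarrow> (nat \<Rightarrow> 'a::real_vector) \<Rightarrow> (nat \<Rightarrow> real) \<Rightarrow> bool" where
  "linear_relation m w a \<longleftrightarrow> (\<Sum>i=1..m. a i *\<^sub>R w i) = 0"

definition columns_basis_of_relations ::
  "nat \<Rightarrow> nat \<Rightarrow> (nat \<Rightarrow> 'a::real_vector) \<Rightarrow> (nat \<Rightarrow> nat \<Rightarrow> real) \<Rightarrow> bool" where
  "columns_basis_of_relations m k w A \<longleftrightarrow>
     (\<forall>j\<in>{1..k}. linear_relation m w (\<lambda>i. A i j)) \<and>
     (\<forall>c. (\<forall>i\<in>{1..m}. (\<Sum>j=1..k. c j * A i j) = 0) \<longrightarrow> (\<forall>j\<in>{1..k}. c j = 0)) \<and>
     (\<forall>a. linear_relation m w a \<longrightarrow> (\<exists>c. \<forall>i\<in>{1..m}. a i = (\<Sum>j=1..k. c j * A i j)))"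

text \<open>A bijection \<open>ix\<close> from the index type \<open>'k\<close> to \<open>{1..k}\<close> numbers the coordinates of
  \<open>\<real>\<^sup>k\<close>: the coordinate \<open>y\<^sub>i\<close> is \<open>y $ j\<close> for the \<open>j\<close> with \<open>ix j = i\<close>.\<close>

definition gale_map :: "nat \<Rightarrow> ('k \<Rightarrow> nat) \<Rightarrow> (nat \<Rightarrow> real ^ 'n) \<Rightarrow> real ^ 'n \<Rightarrow> real ^ 'k" where
  "gale_map n ix w z = (\<chi> j. monomial z (w (n + ix j)))"

definition gale_domain :: "nat \<Rightarrow> (nat \<Rightarrow> real ^ 'k \<Rightarrow> real) \<Rightarrow> (real ^ 'k) set" where
  "gale_domain m p = {y. \<forall>i\<in>{1..m}. p i y > 0}"

definition gale_product ::
  "nat \<Rightarrow> (nat \<Rightarrow> real ^ 'k \<Rightarrow> real) \<Rightarrow> (nat \<Rightarrow> nat \<Rightarrow> real) \<Rightarrow> nat \<Rightarrow> real ^ 'k \<Rightarrow> real" where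
  "gale_product m p A j y = (\<Prod>i=1..m. p i y powr A i j)"

end

theory Submission
  imports Defs
begin

text \<open>Both systems become linear after taking logarithms. Write \<open>x\<close> for the vector of the
  \<open>ln (z $ i)\<close>, so that \<open>monomial z (w i) = exp (x \<bullet> w i)\<close>. With \<open>y = \<phi> z\<close>, the diagonal system
  says that \<open>x \<bullet> w i = ln (p i y)\<close> for \<open>i \<le> n\<close>; for the indices \<open>n + ix j\<close>, where \<open>p\<close> is a
  coordinate, this equation is the definition of \<open>\<phi>\<close>. The Gale system says that the vector of
  the \<open>ln (p i y)\<close> annihilates every linear relation among the \<open>w i\<close>. By linear algebra
  (\<open>inner_family_iff_orthogonal_to_relations\<close>) a vector \<open>r\<close> annihilates the relations iff
  \<open>r i = x \<bullet> w i\<close> for some \<open>x\<close>, and \<open>x\<close> is unique because the \<open>w i\<close> span the space. So \<open>y\<close>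
  solves the Gale system iff it comes from a solution \<open>z\<close> of the diagonal system, and from
  only one.

  For non-degeneracy, there are as many equations as variables in both systems, so the
  differentials are independent iff their common kernel is zero
  (\<open>nondegenerate_at_iff_trivial_kernel\<close>). Put \<open>r i = p' i y h / p i y\<close>, the logarithmic
  derivative of \<open>p i\<close> along \<open>h\<close>. The kernel of the Gale system consists of the \<open>h\<close> for which
  \<open>r\<close> annihilates the relations. In logarithmic coordinates the kernel of the diagonal system
  consists of the \<open>u\<close> with \<open>u \<bullet> w i = r i\<close> for all \<open>i\<close> and some \<open>h\<close>. The same duality, now
  applied to \<open>r\<close>, identifies the two kernels.\<close>

section \<open>Linear relations among finitely many vectors\<close>

lemma independent_prescribed_inner:
  fixes w :: "nat \<Rightarrow> 'a::euclidean_space"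
  assumes "inj_on w J" and "independent (w ` J)"
  obtains x where "\<forall>i\<in>J. x \<bullet> w i = r i"
proof -
  obtain f where "linear f" and f: "\<forall>v\<in>w ` J. f v = r (the_inv_into J w v)"
    using linear_independent_extend[OF assms(2), of "\<lambda>v. r (the_inv_into J w v)"] by auto
  have "adjoint f 1 \<bullet> w i = r i" if "i \<in> J" for i
  proof -
    have "w i \<bullet> adjoint f 1 = f (w i) \<bullet> 1"
      by (rule adjoint_works[OF \<open>linear f\<close>])
    moreover have "f (w i) = r i"
      using f that by (simp add: the_inv_into_f_f[OF assms(1)])
    ultimately show ?thesis
      unfolding inner_commute[of _ "w i"] inner_real_def by simp
  qed
  then show thesis using that by blast
qed

text \<open>Duality: the row space of a matrix is the annihilator of the relations between its
  columns. A vector annihilating the relations is matched on a maximal independent subfamily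
  first; every other member of the family is a combination of that subfamily, and this
  combination is one of the relations, so the match extends to it.\<close>

lemma inner_family_iff_orthogonal_to_relations:
  fixes w :: "nat \<Rightarrow> 'a::euclidean_space"
  assumes A: "columns_basis_of_relations m k w A"
  shows "(\<exists>x. \<forall>i\<in>{1..m}. x \<bullet> w i = r i) \<longleftrightarrow> (\<forall>j\<in>{1..k}. (\<Sum>i=1..m. A i j * r i) = 0)"
    (is "?L \<longleftrightarrow> ?R")
proof
  assume ?L
  then obtain x where x: "\<And>i. i \<in> {1..m} \<Longrightarrow> x \<bullet> w i = r i" by blast
  show ?R
  proof
    fix j assume "j \<in> {1..k}"
    then have "(\<Sum>i=1..m. A i j *\<^sub>R w i) = 0"
      using A by (simp add: columns_basis_of_relations_def linear_relation_def)
    then have "x \<bullet> (\<Sum>i=1..m. A i j *\<^sub>R w i) = 0" by simp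
    then show "(\<Sum>i=1..m. A i j * r i) = 0"
      by (simp add: inner_sum_right x)
  qed
next
  assume R: ?R
  obtain B where B: "B \<subseteq> w ` {1..m}" "independent B" "w ` {1..m} \<subseteq> span B"
    by (rule maximal_independent_subset)
  then obtain J where J: "J \<subseteq> {1..m}" "inj_on w J" "B = w ` J"
    by (auto simp: subset_image_inj)
  have "finite J" using J(1) finite_subset by blast
  obtain x where x: "\<And>i. i \<in> J \<Longrightarrow> x \<bullet> w i = r i"
    using independent_prescribed_inner[OF J(2), of r] B(2) J(3) by metis
  have "x \<bullet> w i = r i" if i: "i \<in> {1..m}" for i
  proof -
    have "w i \<in> span (w ` J)" using B(3) J(3) i by auto
    then obtain u where "w i = (\<Sum>v\<in>w ` J. u v *\<^sub>R v)"
      using \<open>finite J\<close> by (auto simp: span_finite)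
    then have u: "w i = (\<Sum>l\<in>J. u (w l) *\<^sub>R w l)"
      by (simp add: sum.reindex[OF J(2)])
    \<comment> \<open>the relation that expresses \<open>w i\<close> by the independent subfamily\<close>
    define a where "a l = (if l = i then 1 else 0) - (if l \<in> J then u (w l) else 0)" for l
    have a_apply: "(\<Sum>l=1..m. a l *\<^sub>R f l) = f i - (\<Sum>l\<in>J. u (w l) *\<^sub>R f l)"
      for f :: "nat \<Rightarrow> 'b::real_vector"
    proof -
      have "(\<Sum>l=1..m. a l *\<^sub>R f l) = (\<Sum>l=1..m. (if l = i then f l else 0))
          - (\<Sum>l=1..m. (if l \<in> J then u (w l) *\<^sub>R f l else 0))"
        unfolding sum_subtractf[symmetric] by (rule sum.cong) (auto simp: a_def scaleR_left_diff_distrib)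
      also have "\<dots> = f i - (\<Sum>l\<in>J. u (w l) *\<^sub>R f l)"
        using i J(1) by (simp add: sum.delta sum.inter_restrict[symmetric] Int_absorb1)
      finally show ?thesis .
    qed
    have "linear_relation m w a"
      unfolding linear_relation_def a_apply using u by simp
    then obtain c where c: "\<forall>l\<in>{1..m}. a l = (\<Sum>j=1..k. c j * A l j)"
      using A unfolding columns_basis_of_relations_def by blast
    have "(\<Sum>l=1..m. a l *\<^sub>R r l) = (\<Sum>l=1..m. \<Sum>j=1..k. c j * (A l j * r l))"
      using c by (intro sum.cong) (auto simp: sum_distrib_right mult.assoc)
    also have "\<dots> = (\<Sum>j=1..k. c j * (\<Sum>l=1..m. A l j * r l))"
      by (subst sum.swap) (simp add: sum_distrib_left)
    also have "\<dots> = 0" using R by simp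
    finally have "r i = (\<Sum>l\<in>J. u (w l) * r l)" unfolding a_apply by simp
    also have "\<dots> = (\<Sum>l\<in>J. u (w l) * (x \<bullet> w l))" using x by simp
    also have "\<dots> = x \<bullet> w i" by (subst u) (simp add: inner_sum_right)
    finally show ?thesis by simp
  qed
  then show ?L by blast
qed

lemma inner_eq_0_spanning_imp_0:
  fixes x :: "'a::euclidean_space"
  assumes "span S = UNIV" and "\<And>v. v \<in> S \<Longrightarrow> x \<bullet> v = 0"
  shows "x = 0"
proof -
  have "orthogonal x x"
    by (rule orthogonal_to_span[of x S x]) (simp_all add: assms orthogonal_def)
  then show ?thesis by (simp add: orthogonal_def)
qed

section \<open>Non-degeneracy as triviality of the common kernel\<close>

text \<open>As many vectors as dimensions are independent exactly when they span, and a family spans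
  exactly when no nonzero vector is orthogonal to it.\<close>

lemma independent_family_iff_trivial_orthogonal:
  fixes e :: "nat \<Rightarrow> 'a::euclidean_space"
  assumes "finite I" and "card I = DIM('a)"
  shows "inj_on e I \<and> independent (e ` I) \<longleftrightarrow> (\<forall>v. (\<forall>i\<in>I. v \<bullet> e i = 0) \<longrightarrow> v = 0)"
    (is "?L \<longleftrightarrow> ?R")
proof
  assume L: ?L
  then have "dim (e ` I) = DIM('a)"
    using assms by (simp add: dim_eq_card_independent card_image)
  then have "span (e ` I) = UNIV" by (simp add: dim_eq_full)
  then show ?R using inner_eq_0_spanning_imp_0[of "e ` I"] by blast
next
  assume R: ?R
  have span: "span (e ` I) = UNIV"
    using R span_not_UNIV_orthogonal[of "e ` I"] by (metis imageI span_base)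
  then have "DIM('a) \<le> card (e ` I)"
    using assms(1) by (metis dim_UNIV dim_le_card finite_imageI subset_refl)
  then have card: "card (e ` I) = DIM('a)"
    using card_image_le[OF assms(1), of e] assms(2) by simp
  then have "inj_on e I" using assms by (simp add: eq_card_imp_inj_on)
  moreover have "independent (e ` I)"
    by (rule card_le_dim_spanning[of _ UNIV]) (use span card assms(1) in auto)
  ultimately show ?L by blast
qed

text \<open>Functionals and vectors correspond under the inner product, by an isomorphism that
  preserves independence in both directions.\<close>

lemma independent_functionals_iff_trivial_kernel:
  fixes D :: "nat \<Rightarrow> 'a::euclidean_space \<Rightarrow>\<^sub>L real"
  assumes "finite I" and "card I = DIM('a)"
  shows "inj_on D I \<and> independent (D ` I) \<longleftrightarrow> (\<forall>v. (\<forall>i\<in>I. D i v = 0) \<longrightarrow> v = 0)"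
proof -
  define grad :: "('a \<Rightarrow>\<^sub>L real) \<Rightarrow> 'a" where "grad F = (\<Sum>b\<in>Basis. F b *\<^sub>R b)" for F
  have grad: "F v = v \<bullet> grad F" for F :: "'a \<Rightarrow>\<^sub>L real" and v
  proof -
    have "F v = F (\<Sum>b\<in>Basis. (v \<bullet> b) *\<^sub>R b)" by (simp add: euclidean_representation)
    then show ?thesis
      by (simp add: grad_def blinfun.sum_right blinfun.scaleR_right inner_sum_right mult.commute)
  qed
  have inv1: "blinfun_inner_right (grad F) = F" for F
    by (rule blinfun_eqI) (simp add: grad inner_commute)
  have inv2: "grad (blinfun_inner_right v) = v" for v
    by (simp add: grad_def euclidean_representation)
  have "linear grad"
    by (rule linearI) (simp_all add: grad_def blinfun.add_left blinfun.scaleR_left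
        scaleR_left_distrib sum.distrib scaleR_sum_right)
  have "linear (blinfun_inner_right :: 'a \<Rightarrow> _)"
    by (rule bounded_linear.linear) (rule bounded_linear_blinfun_inner_right)
  have "inj grad" by (metis injI inv1)
  have "inj (blinfun_inner_right :: 'a \<Rightarrow> _)" by (metis injI inv2)
  let ?e = "\<lambda>i. grad (D i)"
  have "inj_on D I \<longleftrightarrow> inj_on ?e I"
    using \<open>inj grad\<close> by (auto simp: inj_on_def)
  moreover have "independent (D ` I) \<longleftrightarrow> independent (?e ` I)"
  proof
    assume "independent (D ` I)"
    from linear_independent_injective_image[OF \<open>linear grad\<close> this]
    show "independent (?e ` I)"
      using \<open>inj grad\<close> by (simp add: image_image inj_on_subset)
  next
    assume "independent (?e ` I)"
    from linear_independent_injective_image[OF \<open>linear blinfun_inner_right\<close> this]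
    show "independent (D ` I)"
      using \<open>inj blinfun_inner_right\<close> by (simp add: image_image inj_on_subset inv1)
  qed
  ultimately show ?thesis
    using independent_family_iff_trivial_orthogonal[OF assms, of ?e] by (simp add: grad)
qed

lemma nondegenerate_at_iff_trivial_kernel:
  fixes x :: "'a::euclidean_space"
  assumes "finite I" and "card I = DIM('a)"
    and D: "\<And>i. i \<in> I \<Longrightarrow> ((\<lambda>u. g i u - h i u) has_derivative D i) (at x)"
  shows "nondegenerate_at I g h x \<longleftrightarrow> (\<forall>v. (\<forall>i\<in>I. D i v = 0) \<longrightarrow> v = 0)"
proof
  assume "nondegenerate_at I g h x"
  then obtain E :: "nat \<Rightarrow> 'a \<Rightarrow>\<^sub>L real"
    where E: "\<forall>i\<in>I. ((\<lambda>u. g i u - h i u) has_derivative blinfun_apply (E i)) (at x)"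
      and "inj_on E I" "independent (E ` I)"
    unfolding nondegenerate_at_def by blast
  moreover have "D i = blinfun_apply (E i)" if "i \<in> I" for i
    using has_derivative_unique D E that by blast
  ultimately show "\<forall>v. (\<forall>i\<in>I. D i v = 0) \<longrightarrow> v = 0"
    using independent_functionals_iff_trivial_kernel[OF assms(1,2), of E] by auto
next
  assume kernel: "\<forall>v. (\<forall>i\<in>I. D i v = 0) \<longrightarrow> v = 0"
  define E where "E i = Blinfun (D i)" for i
  have E: "blinfun_apply (E i) = D i" if "i \<in> I" for i
    using has_derivative_bounded_linear[OF D[OF that]] by (simp add: E_def bounded_linear_Blinfun_apply)
  have "inj_on E I \<and> independent (E ` I)"
    using independent_functionals_iff_trivial_kernel[OF assms(1,2), of E] kernel E by auto
  then show "nondegenerate_at I g h x"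
    unfolding nondegenerate_at_def using D E by (intro exI[of _ E]) auto
qed

section \<open>Monomials in logarithmic coordinates\<close>

definition log_coords :: "real ^ 'm \<Rightarrow> real ^ 'm" where
  "log_coords z = (\<chi> i. ln (z $ i))"

lemma prod_powr_eq_exp:
  fixes f a :: "'i \<Rightarrow> real"
  assumes "finite I" and "\<And>i. i \<in> I \<Longrightarrow> 0 < f i"
  shows "(\<Prod>i\<in>I. f i powr a i) = exp (\<Sum>i\<in>I. a i * ln (f i))"
proof -
  have "f i powr a i = exp (a i * ln (f i))" if "i \<in> I" for i
    using assms(2)[OF that] by (simp add: powr_def)
  then show ?thesis by (simp add: exp_sum[OF assms(1)])
qed

lemma monomial_eq_exp:
  assumes "z \<in> pos_orthant"
  shows "monomial z v = exp (log_coords z \<bullet> v)"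
proof -
  have "monomial z v = exp (\<Sum>i\<in>UNIV. v $ i * ln (z $ i))"
    unfolding monomial_def using assms by (intro prod_powr_eq_exp) (simp_all add: pos_orthant_def)
  then show ?thesis by (simp add: log_coords_def inner_vec_def mult.commute)
qed

lemma monomial_pos: "z \<in> pos_orthant \<Longrightarrow> 0 < monomial z v"
  by (simp add: monomial_eq_exp)

lemma pos_orthant_log_coords_surj:
  obtains z where "z \<in> pos_orthant" and "log_coords z = x"
  by (rule that[of "\<chi> i. exp (x $ i)"]) (simp_all add: pos_orthant_def log_coords_def vec_eq_iff)

lemma log_coords_inject:
  assumes "z \<in> pos_orthant" and "z' \<in> pos_orthant"
  shows "log_coords z = log_coords z' \<longleftrightarrow> z = z'"
  using assms by (auto simp: pos_orthant_def log_coords_def vec_eq_iff)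

text \<open>Logarithmic differentiation of a product of real powers.\<close>

lemma has_derivative_prod_powr:
  fixes f :: "'i \<Rightarrow> 'a::real_normed_vector \<Rightarrow> real"
  assumes "finite I" and "\<And>i. i \<in> I \<Longrightarrow> (f i has_derivative f' i) (at x)"
    and "\<And>i. i \<in> I \<Longrightarrow> 0 < f i x"
  shows "((\<lambda>u. \<Prod>i\<in>I. f i u powr a i) has_derivative
      (\<lambda>h. (\<Prod>i\<in>I. f i x powr a i) * (\<Sum>i\<in>I. a i * (f' i h / f i x)))) (at x)"
  using assms
proof (induction I rule: finite_induct)
  case empty
  then show ?case by simp
next
  case (insert j I)
  have "((\<lambda>u. f j u powr a j) has_derivative
      (\<lambda>h. (f j x powr a j) * (0 * ln (f j x) + f' j h * a j / f j x))) (at x)"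
    by (rule has_derivative_powr) (use insert.prems in auto)
  moreover have "((\<lambda>u. \<Prod>i\<in>I. f i u powr a i) has_derivative
      (\<lambda>h. (\<Prod>i\<in>I. f i x powr a i) * (\<Sum>i\<in>I. a i * (f' i h / f i x)))) (at x)"
    by (rule insert.IH) (use insert.prems in auto)
  ultimately have "((\<lambda>u. f j u powr a j * (\<Prod>i\<in>I. f i u powr a i)) has_derivative
      (\<lambda>h. f j x powr a j * ((\<Prod>i\<in>I. f i x powr a i) * (\<Sum>i\<in>I. a i * (f' i h / f i x)))
        + f j x powr a j * (0 * ln (f j x) + f' j h * a j / f j x) * (\<Prod>i\<in>I. f i x powr a i))) (at x)"
    by (rule has_derivative_mult)
  then show ?case
    using insert.hyps by (simp add: algebra_simps)
qed

lemma has_derivative_monomial: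
  assumes "z \<in> pos_orthant"
  shows "((\<lambda>u. monomial u v) has_derivative (\<lambda>h. monomial z v * ((\<chi> i. h $ i / z $ i) \<bullet> v))) (at z)"
proof -
  have "((\<lambda>u. \<Prod>i\<in>UNIV. u $ i powr v $ i) has_derivative
      (\<lambda>h. (\<Prod>i\<in>UNIV. z $ i powr v $ i) * (\<Sum>i\<in>UNIV. v $ i * (h $ i / z $ i)))) (at z)"
    using assms
    by (intro has_derivative_prod_powr)
      (auto simp: pos_orthant_def intro!: bounded_linear.has_derivative[OF bounded_linear_vec_nth] has_derivative_ident)
  then show ?thesis
    by (simp add: monomial_def inner_vec_def mult.commute)
qed

section \<open>The diagonal system and its Gale dual\<close>

text \<open>This is the generality of the argument. Spanning makes a vector determined by its inner
  products with the \<open>w i\<close>, which gives injectivity both for solutions and for tangent vectors;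
  the differentials \<open>p'\<close> enter through the logarithmic derivatives.\<close>

locale gale_duality =
  fixes n k :: nat
    and ix :: "'k::finite \<Rightarrow> nat"
    and w :: "nat \<Rightarrow> real ^ 'n::finite"
    and p :: "nat \<Rightarrow> real ^ 'k \<Rightarrow> real"
    and p' :: "nat \<Rightarrow> real ^ 'k \<Rightarrow> real ^ 'k \<Rightarrow> real"
    and A :: "nat \<Rightarrow> nat \<Rightarrow> real"
  assumes n: "n = CARD('n)" and k: "k = CARD('k)"
    and ix: "bij_betw ix UNIV {1..k}"
    and spanning: "span (w ` {1..n + k}) = UNIV"
    and p_coord: "p (n + ix j) y = y $ j"
    and p': "i \<in> {1..n + k} \<Longrightarrow> (p i has_derivative p' i y) (at y)"
    and A: "columns_basis_of_relations (n + k) k w A"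
begin

abbreviation \<phi> where "\<phi> \<equiv> gale_map n ix w"
abbreviation \<Delta> where "\<Delta> \<equiv> gale_domain (n + k) p"
abbreviation diagonal_lhs :: "nat \<Rightarrow> real ^ 'n \<Rightarrow> real"
  where "diagonal_lhs \<equiv> \<lambda>i z. monomial z (w i)"
abbreviation diagonal_rhs :: "nat \<Rightarrow> real ^ 'n \<Rightarrow> real"
  where "diagonal_rhs \<equiv> \<lambda>i z. p i (\<phi> z)"
abbreviation diagonal_solutions
  where "diagonal_solutions \<equiv> solutions pos_orthant {1..n} diagonal_lhs diagonal_rhs"
abbreviation gale_solutions
  where "gale_solutions \<equiv> solutions \<Delta> {1..k} (\<lambda>j y. 1) (gale_product (n + k) p A)"

lemma gale_map_nth [simp]: "\<phi> z $ j = monomial z (w (n + ix j))"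
  by (simp add: gale_map_def)

lemma coord_index: "n + ix j \<in> {1..n + k}"
proof -
  have "ix j \<in> {1..k}" using ix bij_betwE by blast
  then show ?thesis by auto
qed

lemma index_cases:
  assumes "i \<in> {1..n + k}"
  obtains "i \<in> {1..n}" | j where "i = n + ix j"
proof (cases "i \<le> n")
  case True
  with assms that(1) show thesis by auto
next
  case False
  then have "i - n \<in> {1..k}" using assms by auto
  then obtain j where "i - n = ix j" using ix by (metis bij_betw_imp_surj_on imageE)
  with False that(2)[of j] show thesis by auto
qed

lemma p_coord_derivative: "p' (n + ix j) y h = h $ j"
proof -
  have "(p (n + ix j) has_derivative (\<lambda>h. h $ j)) (at y)"
    unfolding p_coord by (intro bounded_linear_imp_has_derivative bounded_linear_vec_nth)
  then show ?thesis
    using has_derivative_unique[OF p'[OF coord_index]] by metis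
qed

lemma gale_map_pos: "\<phi> ` pos_orthant \<subseteq> pos_orthant"
  by (auto simp: pos_orthant_def[where 'm='k] monomial_pos)

lemma gale_domain_pos: "\<Delta> \<subseteq> pos_orthant"
proof
  fix y assume "y \<in> \<Delta>"
  then have "0 < p (n + ix j) y" for j
    using coord_index[of j] unfolding gale_domain_def by blast
  then show "y \<in> pos_orthant" by (simp add: p_coord pos_orthant_def)
qed

text \<open>Adjoining the trivial equations for the coordinates of \<open>y = \<phi> z\<close> turns the diagonal
  system into one equation for each vector \<open>w i\<close>.\<close>

lemma diagonal_solution_iff_monomials:
  "z \<in> diagonal_solutions \<and> y = \<phi> z \<longleftrightarrow>
    z \<in> pos_orthant \<and> (\<forall>i\<in>{1..n + k}. monomial z (w i) = p i y)"
  (is "?L \<longleftrightarrow> ?R")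
proof
  assume ?L
  then have z: "z \<in> pos_orthant" "y = \<phi> z" "\<And>i. i \<in> {1..n} \<Longrightarrow> monomial z (w i) = p i y"
    by (simp_all add: solutions_def)
  have "monomial z (w i) = p i y" if "i \<in> {1..n + k}" for i
    using that by (cases rule: index_cases) (simp_all add: z(2,3) p_coord)
  with z(1) show ?R by blast
next
  assume R: ?R
  then have "\<phi> z $ j = y $ j" for j
    using coord_index[of j] by (simp add: p_coord)
  then have "y = \<phi> z" by (simp add: vec_eq_iff)
  with R show ?L by (auto simp: solutions_def)
qed

lemma gale_product_eq_exp:
  assumes "y \<in> \<Delta>"
  shows "gale_product (n + k) p A j y = exp (\<Sum>i=1..n + k. A i j * ln (p i y))"
  unfolding gale_product_def
  by (rule prod_powr_eq_exp) (use assms in \<open>simp_all add: gale_domain_def\<close>)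

text \<open>In logarithmic coordinates both sides are linear: the Gale system says that the vector
  of the \<open>ln (p i y)\<close> annihilates the relations, so that it consists of the inner products
  of one vector with the \<open>w i\<close>.\<close>

lemma gale_solution_iff_monomials:
  "y \<in> gale_solutions \<longleftrightarrow>
    (\<exists>z\<in>pos_orthant. \<forall>i\<in>{1..n + k}. monomial z (w i) = p i y)"
proof (cases "y \<in> \<Delta>")
  case True
  have monomial_iff: "monomial z (w i) = p i y \<longleftrightarrow> log_coords z \<bullet> w i = ln (p i y)"
    if "z \<in> pos_orthant" "i \<in> {1..n + k}" for z i
  proof -
    have "0 < p i y" using True that(2) by (simp add: gale_domain_def)
    then show ?thesis
      by (simp add: monomial_eq_exp[OF that(1)]) (metis exp_ln ln_exp)
  qed
  have "y \<in> gale_solutions \<longleftrightarrow> (\<forall>j\<in>{1..k}. (\<Sum>i=1..n + k. A i j * ln (p i y)) = 0)"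
    using True by (auto simp: solutions_def gale_product_eq_exp)
  also have "\<dots> \<longleftrightarrow> (\<exists>x. \<forall>i\<in>{1..n + k}. x \<bullet> w i = ln (p i y))"
    by (rule inner_family_iff_orthogonal_to_relations[OF A, symmetric])
  also have "\<dots> \<longleftrightarrow> (\<exists>z\<in>pos_orthant. \<forall>i\<in>{1..n + k}. log_coords z \<bullet> w i = ln (p i y))"
    by (metis pos_orthant_log_coords_surj)
  also have "\<dots> \<longleftrightarrow> (\<exists>z\<in>pos_orthant. \<forall>i\<in>{1..n + k}. monomial z (w i) = p i y)"
    using monomial_iff by (intro bex_cong ball_cong) auto
  finally show ?thesis .
next
  case False
  have "\<not> (\<forall>i\<in>{1..n + k}. monomial z (w i) = p i y)" if "z \<in> pos_orthant" for z
  proof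
    assume "\<forall>i\<in>{1..n + k}. monomial z (w i) = p i y"
    then have "0 < p i y" if "i \<in> {1..n + k}" for i
      using that monomial_pos[OF \<open>z \<in> pos_orthant\<close>, of "w i"] by simp
    with False show False by (simp add: gale_domain_def)
  qed
  with False show ?thesis by (auto simp: solutions_def)
qed

lemma monomials_inject:
  assumes "z \<in> pos_orthant" and "z' \<in> pos_orthant"
    and "\<And>i. i \<in> {1..n + k} \<Longrightarrow> monomial z (w i) = monomial z' (w i)"
  shows "z = z'"
proof -
  have "log_coords z - log_coords z' = 0"
    by (rule inner_eq_0_spanning_imp_0[OF spanning])
      (use assms in \<open>auto simp: monomial_eq_exp inner_diff_left\<close>)
  then show ?thesis using log_coords_inject[OF assms(1,2)] by simp
qed

lemma bij_betw_solutions: "bij_betw \<phi> diagonal_solutions gale_solutions"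
  unfolding bij_betw_def
proof
  show "inj_on \<phi> diagonal_solutions"
  proof (rule inj_onI)
    fix z z' assume *: "z \<in> diagonal_solutions" "z' \<in> diagonal_solutions" "\<phi> z = \<phi> z'"
    show "z = z'"
      using diagonal_solution_iff_monomials[of z "\<phi> z"] diagonal_solution_iff_monomials[of z' "\<phi> z"] *
      by (intro monomials_inject) auto
  qed
  show "\<phi> ` diagonal_solutions = gale_solutions"
    unfolding set_eq_iff image_iff gale_solution_iff_monomials
    using diagonal_solution_iff_monomials by blast
qed

lemma has_derivative_gale_map:
  assumes "z \<in> pos_orthant"
  shows "(\<phi> has_derivative
    (\<lambda>v. \<chi> j. monomial z (w (n + ix j)) * ((\<chi> i. v $ i / z $ i) \<bullet> w (n + ix j)))) (at z)"
proof (subst has_derivative_componentwise_within, rule ballI)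
  fix b :: "real ^ 'k" assume "b \<in> Basis"
  then obtain j where b: "b = axis j 1" by (auto simp: Basis_vec_def)
  show "((\<lambda>u. \<phi> u \<bullet> b) has_derivative
      (\<lambda>v. (\<chi> j. monomial z (w (n + ix j)) * ((\<chi> i. v $ i / z $ i) \<bullet> w (n + ix j))) \<bullet> b)) (at z)"
    unfolding b inner_axis gale_map_nth vec_lambda_beta inner_real_def mult_1_right
    by (rule has_derivative_monomial[OF assms])
qed

text \<open>A tangent vector \<open>v\<close> at \<open>z\<close> corresponds to \<open>u = v / z\<close> in logarithmic coordinates. The
  differentials of the diagonal system vanish on \<open>v\<close> exactly when, for the image \<open>h\<close> of \<open>v\<close>
  under the differential of the map, the logarithmic derivatives of all \<open>p i\<close> along \<open>h\<close> are
  the inner products of \<open>u\<close> with the \<open>w i\<close>.\<close>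

lemma nondegenerate_diagonal_iff:
  assumes z: "z \<in> diagonal_solutions" and y: "y = \<phi> z"
  shows "nondegenerate_at {1..n} diagonal_lhs diagonal_rhs z \<longleftrightarrow>
    (\<forall>u h. (\<forall>i\<in>{1..n + k}. u \<bullet> w i = p' i y h / p i y) \<longrightarrow> u = 0)"
proof -
  have zpos: "z \<in> pos_orthant" and mon: "\<And>i. i \<in> {1..n + k} \<Longrightarrow> monomial z (w i) = p i y"
    using diagonal_solution_iff_monomials[of z y] z y by auto
  have ppos: "0 < p i y" if "i \<in> {1..n + k}" for i
    using monomial_pos[OF zpos] mon[OF that] by metis
  define d\<phi> :: "real ^ 'n \<Rightarrow> real ^ 'k" where "d\<phi> u = (\<chi> j. y $ j * (u \<bullet> w (n + ix j)))" for u
  define scale :: "real ^ 'n \<Rightarrow> real ^ 'n" where "scale v = (\<chi> i. v $ i / z $ i)" for v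
  have z_nz: "z $ i \<noteq> 0" for i
  proof -
    have "0 < z $ i" using zpos by (simp add: pos_orthant_def)
    then show ?thesis by simp
  qed
  have dphi: "(\<phi> has_derivative (\<lambda>v. d\<phi> (scale v))) (at z)"
    using has_derivative_gale_map[OF zpos] y by (simp add: d\<phi>_def scale_def)
  have deriv: "((\<lambda>x. diagonal_lhs i x - diagonal_rhs i x) has_derivative
      (\<lambda>v. p i y * (scale v \<bullet> w i) - p' i y (d\<phi> (scale v)))) (at z)" if "i \<in> {1..n}" for i
  proof -
    have i: "i \<in> {1..n + k}" using that by auto
    have "((\<lambda>x. p i (\<phi> x)) has_derivative (\<lambda>v. p' i y (d\<phi> (scale v)))) (at z)"
      using has_derivative_compose[OF dphi] p'[OF i, of y] y by blast
    moreover have "((\<lambda>x. monomial x (w i)) has_derivative (\<lambda>v. p i y * (scale v \<bullet> w i))) (at z)"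
      using has_derivative_monomial[OF zpos, of "w i"] by (simp add: mon[OF i] scale_def)
    ultimately show ?thesis by (intro has_derivative_diff)
  qed
  \<comment> \<open>The indices \<open>n + ix j\<close> alone already force \<open>h\<close> to be the image of \<open>u\<close>.\<close>
  have h_eq: "h = d\<phi> u" if "\<forall>i\<in>{1..n + k}. u \<bullet> w i = p' i y h / p i y" for u h
  proof -
    have "u \<bullet> w (n + ix j) = h $ j / y $ j" for j
      using that coord_index[of j] by (simp add: p_coord p_coord_derivative)
    moreover have "y $ j \<noteq> 0" for j using ppos[OF coord_index[of j]] by (simp add: p_coord)
    ultimately show ?thesis by (simp add: d\<phi>_def vec_eq_iff)
  qed
  have kernel: "(\<forall>i\<in>{1..n}. p i y * (u \<bullet> w i) - p' i y (d\<phi> u) = 0) \<longleftrightarrow>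
      (\<exists>h. \<forall>i\<in>{1..n + k}. u \<bullet> w i = p' i y h / p i y)" (is "?K \<longleftrightarrow> ?E") for u
  proof
    assume K: ?K
    have "u \<bullet> w i = p' i y (d\<phi> u) / p i y" if i: "i \<in> {1..n + k}" for i
      using i
    proof (cases rule: index_cases)
      case 1
      with K ppos[OF i] show ?thesis by (simp add: field_simps)
    next
      case (2 j)
      have "y $ j \<noteq> 0" using ppos[OF i] 2 by (simp add: p_coord)
      then show ?thesis unfolding 2 by (simp add: p_coord p_coord_derivative d\<phi>_def)
    qed
    then show ?E by blast
  next
    assume ?E
    then have "u \<bullet> w i = p' i y (d\<phi> u) / p i y" if "i \<in> {1..n + k}" for i
      using h_eq that by blast
    then have "p i y * (u \<bullet> w i) = p' i y (d\<phi> u)" if "i \<in> {1..n}" for i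
      using that ppos[of i] by (simp add: field_simps)
    then show ?K by simp
  qed
  have "nondegenerate_at {1..n} diagonal_lhs diagonal_rhs z \<longleftrightarrow>
    (\<forall>v. (\<forall>i\<in>{1..n}. p i y * (scale v \<bullet> w i) - p' i y (d\<phi> (scale v)) = 0) \<longrightarrow> v = 0)"
    by (rule nondegenerate_at_iff_trivial_kernel) (use deriv n in auto)
  also have "\<dots> \<longleftrightarrow> (\<forall>v. (\<exists>h. \<forall>i\<in>{1..n + k}. scale v \<bullet> w i = p' i y h / p i y) \<longrightarrow> v = 0)"
    unfolding kernel ..
  also have "\<dots> \<longleftrightarrow> (\<forall>u. (\<exists>h. \<forall>i\<in>{1..n + k}. u \<bullet> w i = p' i y h / p i y) \<longrightarrow> u = 0)"
  proof -
    have surj: "\<exists>v. scale v = u" for u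
      by (rule exI[of _ "\<chi> i. u $ i * z $ i"]) (simp add: scale_def vec_eq_iff z_nz)
    have zero: "scale v = 0 \<longleftrightarrow> v = 0" for v
      by (simp add: scale_def vec_eq_iff z_nz)
    show ?thesis
    proof (intro iffI allI impI)
      fix u
      assume kernel_0: "\<forall>v. (\<exists>h. \<forall>i\<in>{1..n + k}. scale v \<bullet> w i = p' i y h / p i y) \<longrightarrow> v = 0"
        and u: "\<exists>h. \<forall>i\<in>{1..n + k}. u \<bullet> w i = p' i y h / p i y"
      obtain v where v: "scale v = u" using surj by blast
      have "v = 0" by (rule kernel_0[rule_format]) (use u v in simp)
      with v zero show "u = 0" by blast
    next
      fix v
      assume kernel_0: "\<forall>u. (\<exists>h. \<forall>i\<in>{1..n + k}. u \<bullet> w i = p' i y h / p i y) \<longrightarrow> u = 0"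
        and v: "\<exists>h. \<forall>i\<in>{1..n + k}. scale v \<bullet> w i = p' i y h / p i y"
      have "scale v = 0" by (rule kernel_0[rule_format]) (use v in simp)
      with zero show "v = 0" by blast
    qed
  qed
  finally show ?thesis by blast
qed

text \<open>By the duality applied to the logarithmic derivatives of the \<open>p i\<close>, the differentials
  of the Gale system vanish on \<open>h\<close> exactly when some \<open>u\<close> as above exists.\<close>

lemma nondegenerate_gale_iff:
  assumes y: "y \<in> gale_solutions"
  shows "nondegenerate_at {1..k} (\<lambda>j y. 1) (gale_product (n + k) p A) y \<longleftrightarrow>
    (\<forall>u h. (\<forall>i\<in>{1..n + k}. u \<bullet> w i = p' i y h / p i y) \<longrightarrow> h = 0)"
proof -
  have ppos: "0 < p i y" if "i \<in> {1..n + k}" for i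
    using y that by (auto simp: solutions_def gale_domain_def)
  have deriv: "((\<lambda>x. 1 - gale_product (n + k) p A j x) has_derivative
      (\<lambda>h. - (\<Sum>i=1..n + k. A i j * (p' i y h / p i y)))) (at y)" if "j \<in> {1..k}" for j
  proof -
    have "(gale_product (n + k) p A j has_derivative
        (\<lambda>h. gale_product (n + k) p A j y * (\<Sum>i=1..n + k. A i j * (p' i y h / p i y)))) (at y)"
      unfolding gale_product_def by (rule has_derivative_prod_powr) (use p' ppos in auto)
    moreover have "gale_product (n + k) p A j y = 1"
      using y that by (auto simp: solutions_def)
    ultimately have "(gale_product (n + k) p A j has_derivative
        (\<lambda>h. \<Sum>i=1..n + k. A i j * (p' i y h / p i y))) (at y)" by simp
    from has_derivative_diff[OF has_derivative_const this] show ?thesis by simp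
  qed
  have "nondegenerate_at {1..k} (\<lambda>j y. 1) (gale_product (n + k) p A) y \<longleftrightarrow>
      (\<forall>h. (\<forall>j\<in>{1..k}. - (\<Sum>i=1..n + k. A i j * (p' i y h / p i y)) = 0) \<longrightarrow> h = 0)"
    by (rule nondegenerate_at_iff_trivial_kernel) (use deriv k in auto)
  also have "\<dots> \<longleftrightarrow> (\<forall>h. (\<exists>u. \<forall>i\<in>{1..n + k}. u \<bullet> w i = p' i y h / p i y) \<longrightarrow> h = 0)"
    unfolding inner_family_iff_orthogonal_to_relations[OF A] by simp
  finally show ?thesis by blast
qed

text \<open>Both kernels are projections of the same space of pairs \<open>(u, h)\<close>, in which each
  component determines the other: \<open>u = 0\<close> forces \<open>h = 0\<close> through the coordinates
  \<open>p (n + ix j)\<close>, and \<open>h = 0\<close> forces \<open>u = 0\<close> because the \<open>w i\<close> span.\<close>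

lemma nondegenerate_iff:
  assumes z: "z \<in> diagonal_solutions"
  shows "nondegenerate_at {1..n} diagonal_lhs diagonal_rhs z \<longleftrightarrow>
    nondegenerate_at {1..k} (\<lambda>j y. 1) (gale_product (n + k) p A) (\<phi> z)"
proof -
  let ?y = "\<phi> z"
  have y: "?y \<in> gale_solutions" using bij_betw_solutions z bij_betwE by blast
  have "u = 0 \<longleftrightarrow> h = 0" if uh: "\<forall>i\<in>{1..n + k}. u \<bullet> w i = p' i ?y h / p i ?y" for u h
  proof
    assume "u = 0"
    then have "h $ j / ?y $ j = 0" for j
      using bspec[OF uh coord_index[of j]] by (simp add: p_coord p_coord_derivative del: gale_map_nth)
    moreover have "?y $ j \<noteq> 0" for j
      using z monomial_pos[of z "w (n + ix j)"] by (simp add: solutions_def)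
    ultimately have "h $ j = 0" for j by (metis divide_eq_0_iff)
    then show "h = 0" by (simp add: vec_eq_iff)
  next
    assume "h = 0"
    have "p' i ?y 0 = 0" if "i \<in> {1..n + k}" for i
      using has_derivative_linear[OF p'[OF that]] linear_0 by blast
    with uh \<open>h = 0\<close> have "u \<bullet> v = 0" if "v \<in> w ` {1..n + k}" for v using that by auto
    then show "u = 0" by (rule inner_eq_0_spanning_imp_0[OF spanning])
  qed
  with y show ?thesis
    unfolding nondegenerate_diagonal_iff[OF z refl] nondegenerate_gale_iff[OF y] by blast
qed

lemma bij_betw_nondeg_solutions:
  "bij_betw \<phi> (nondeg_solutions pos_orthant {1..n} diagonal_lhs diagonal_rhs)
    (nondeg_solutions \<Delta> {1..k} (\<lambda>j y. 1) (gale_product (n + k) p A))"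
proof -
  have image: "\<phi> ` diagonal_solutions = gale_solutions"
    using bij_betw_solutions by (rule bij_betw_imp_surj_on)
  have "\<phi> ` {z \<in> diagonal_solutions. nondegenerate_at {1..n} diagonal_lhs diagonal_rhs z} =
      {y \<in> gale_solutions. nondegenerate_at {1..k} (\<lambda>j y. 1) (gale_product (n + k) p A) y}"
    unfolding image[symmetric] by (auto simp only: nondegenerate_iff image_iff mem_Collect_eq)
  then show ?thesis
    unfolding nondeg_solutions_def by (rule bij_betw_subset[OF bij_betw_solutions Collect_restrict])
qed

end

section \<open>Gale duality\<close>

lemma poly_deg_le_1_differentiable:
  assumes "poly_deg_le_1 p"
  shows "p differentiable (at y)"
proof -
  obtain c b where "\<forall>y. p y = c + (\<Sum>j\<in>UNIV. b $ j * y $ j)"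
    using assms unfolding poly_deg_le_1_def by (elim exE)
  then have p: "p = (\<lambda>y. c + (\<Sum>j\<in>UNIV. b $ j * y $ j))" by (intro ext) simp
  have "(\<lambda>y. y $ j) differentiable (at y)" for j
    by (intro bounded_linear_imp_differentiable bounded_linear_vec_nth)
  then show ?thesis unfolding p by simp
qed

theorem theorem2p2:
  fixes n k :: nat
    and ix :: "'k::finite \<Rightarrow> nat"
    and w :: "nat \<Rightarrow> real ^ 'n::finite"
    and p :: "nat \<Rightarrow> real ^ 'k \<Rightarrow> real"
    and A :: "nat \<Rightarrow> nat \<Rightarrow> real"
  defines "\<phi> \<equiv> gale_map n ix w"
    and "\<Delta> \<equiv> gale_domain (n + k) p"
  assumes "n = CARD('n)" and "k = CARD('k)"
    and "bij_betw ix UNIV {1..k}"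
    and "card (insert 0 (w ` {1..n + k})) = n + k + 1"
    and "independent (w ` {k + 1..n + k})"
    and "\<forall>i\<in>{1..n}. poly_deg_le_1 (p i)"
    and "\<forall>j y. p (n + ix j) y = y $ j"
    and "columns_basis_of_relations (n + k) k w A"
  shows "\<phi> ` pos_orthant \<subseteq> pos_orthant \<and> \<Delta> \<subseteq> pos_orthant
    \<and> bij_betw \<phi>
        (solutions pos_orthant {1..n} (\<lambda>i z. monomial z (w i)) (\<lambda>i z. p i (\<phi> z)))
        (solutions \<Delta> {1..k} (\<lambda>j y. 1) (gale_product (n + k) p A))
    \<and> bij_betw \<phi>
        (nondeg_solutions pos_orthant {1..n} (\<lambda>i z. monomial z (w i)) (\<lambda>i z. p i (\<phi> z)))
        (nondeg_solutions \<Delta> {1..k} (\<lambda>j y. 1) (gale_product (n + k) p A))"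
proof -
  \<comment> \<open>Distinctness makes the independent vectors \<open>n\<close> in number, hence a basis.\<close>
  have "card (w ` {1..n + k}) \<ge> n + k"
    using assms(6) by (simp add: card_insert_if split: if_splits)
  then have "inj_on w {1..n + k}"
    using card_image_le[of "{1..n + k}" w] by (intro eq_card_imp_inj_on) auto
  then have "inj_on w {k + 1..n + k}" by (rule inj_on_subset) auto
  then have "dim (w ` {k + 1..n + k}) = DIM(real ^ 'n)"
    using assms(3,7) by (simp add: dim_eq_card_independent card_image)
  then have "span (w ` {k + 1..n + k}) = UNIV" by (simp only: dim_eq_full)
  moreover have "span (w ` {k + 1..n + k}) \<subseteq> span (w ` {1..n + k})"
    by (intro span_mono image_mono) auto
  ultimately have spanning: "span (w ` {1..n + k}) = UNIV" by auto
  have "p i differentiable (at y)" if i: "i \<in> {1..n + k}" for i y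
  proof (cases "i \<le> n")
    case True
    with i assms(8) show ?thesis by (simp add: poly_deg_le_1_differentiable)
  next
    case False
    then have "i - n \<in> {1..k}" using i by auto
    then obtain j where "i - n = ix j" using assms(5) by (metis bij_betw_imp_surj_on imageE)
    with False have "i = n + ix j" by simp
    with assms(9) have "p i = (\<lambda>y. y $ j)" by (intro ext) simp
    then show ?thesis
      using bounded_linear_imp_differentiable[OF bounded_linear_vec_nth] by simp
  qed
  then have deriv: "(p i has_derivative frechet_derivative (p i) (at y)) (at y)"
    if "i \<in> {1..n + k}" for i y
    using that by (simp add: frechet_derivative_works)
  interpret gale_duality n k ix w p "\<lambda>i y. frechet_derivative (p i) (at y)" A
    by unfold_locales (use assms spanning deriv in auto)
  show ?thesis
    unfolding \<phi>_def \<Delta>_def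
    by (intro conjI gale_map_pos gale_domain_pos bij_betw_solutions bij_betw_nondeg_solutions)
qed

end
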